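(* (i) For any Boolean function $f$, $\textsc{HGP}(f)$, $\textsc{HGP}^3(f)$ and $\textsc{NBC}(f)$ are polynomially related. (ii) For any monotone Boolean function $f$, $\textsc{HGP}_{+}(f)$, $\textsc{HGP}^3_{+}(f)$ and $\textsc{NBC}_{+}(f)$ are polynomially related.
   Context: A hypergraph program (HGP) is a hypergraph $H=(V,E)$ whose vertices are labelled with $0$, $1$, $p_i$ or $\neg p_i$; it computes $f$ if for every input $\vec{\alpha}$, $f(\vec{\alpha})=1$ iff some set of pairwise disjoint hyperedges contains every vertex whose label evaluates to $0$ under $\vec\alpha$. It is monotone if no label is a negated variable; its size is the number of hyperedges; it has degree $\le n$ if every vertex lies in at most $n$ hyperedges. $\textsc{HGP}(f)$ and $\textsc{HGP}^n(f)$ are the minimal sizes of HGPs (resp. of degree $\le n$) computing $f$; $\textsc{HGP}_{+}(f)$, $\textsc{HGP}^n_{+}(f)$ are the same for monotone HGPs. A nondeterministic Boolean circuit $\boldsymbol{C}(\vec{x},\vec{y})$ with $|\vec{x}|=n$ computes $f\colon\{0,1\}^n\to\{0,1\}$ if for every $\vec{\alpha}\in\{0,1\}^n$, $f(\vec{\alpha})=1$ iff there is $\vec{\beta}$ with $\boldsymbol{C}(\vec{\alpha},\vec{\beta})=1$; the $\vec y$ are advice variables. It is monotone if negations are applied only to advice variables. $\textsc{NBC}(f)$ (resp. $\textsc{NBC}_{+}(f)$) is the minimal size of a (monotone) nondeterministic circuit computing $f$. Measures are polynomially related if each is bounded by a polynomial in any other.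
   Formalization: The bounds on HGP^3 by HGP, and on NBC by HGP or HGP^3 (and monotone versions), are polynomial in that measure plus the number n of variables; without n they fail, e.g. the conjunction of n variables has a program with no hyperedges but needs n-1 gates. *)

theory Defs
  imports Main "HOL-Library.Disjoint_Sets" "HOL-Computational_Algebra.Polynomial"
begin

text \<open>
  A Boolean function of \<open>n\<close> variables is a function \<open>f :: bool list \<Rightarrow> bool\<close> of which only the values
  on lists of length \<open>n\<close> matter; variables are numbered from \<open>0\<close>.
\<close>

definition mono_boolfun :: "nat \<Rightarrow> (bool list \<Rightarrow> bool) \<Rightarrow> bool" where
  "mono_boolfun n f \<longleftrightarrow>
     (\<forall>\<alpha> \<beta>. length \<alpha> = n \<and> length \<beta> = n \<and> list_all2 (\<le>) \<alpha> \<beta> \<longrightarrow> f \<alpha> \<le> f \<beta>)"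


subsection \<open>Hypergraph programs\<close>

datatype label = Const bool | Pos nat | Neg nat

fun label_val :: "bool list \<Rightarrow> label \<Rightarrow> bool" where
  "label_val \<alpha> (Const b) = b"
| "label_val \<alpha> (Pos i) = \<alpha> ! i"
| "label_val \<alpha> (Neg i) = (\<not> \<alpha> ! i)"

fun label_ok :: "nat \<Rightarrow> label \<Rightarrow> bool" where
  "label_ok n (Const b) = True"
| "label_ok n (Pos i) = (i < n)"
| "label_ok n (Neg i) = (i < n)"

record 'v hgp =
  verts :: "'v set"
  hedges :: "'v set set"
  lab :: "'v \<Rightarrow> label"

definition is_hgp :: "nat \<Rightarrow> 'v hgp \<Rightarrow> bool" where
  "is_hgp n P \<longleftrightarrow>
     finite (verts P) \<and> hedges P \<subseteq> Pow (verts P) \<and> (\<forall>v\<in>verts P. label_ok n (lab P v))"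

definition hgp_accepts :: "'v hgp \<Rightarrow> bool list \<Rightarrow> bool" where
  "hgp_accepts P \<alpha> \<longleftrightarrow>
     (\<exists>M \<subseteq> hedges P. disjoint M \<and> {v \<in> verts P. \<not> label_val \<alpha> (lab P v)} \<subseteq> \<Union>M)"

definition hgp_computes :: "nat \<Rightarrow> 'v hgp \<Rightarrow> (bool list \<Rightarrow> bool) \<Rightarrow> bool" where
  "hgp_computes n P f \<longleftrightarrow> is_hgp n P \<and> (\<forall>\<alpha>. length \<alpha> = n \<longrightarrow> (f \<alpha> \<longleftrightarrow> hgp_accepts P \<alpha>))"

definition hgp_mono :: "'v hgp \<Rightarrow> bool" where
  "hgp_mono P \<longleftrightarrow> (\<forall>v\<in>verts P. \<forall>i. lab P v \<noteq> Neg i)"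

definition hgp_degree_le :: "nat \<Rightarrow> 'v hgp \<Rightarrow> bool" where
  "hgp_degree_le d P \<longleftrightarrow> (\<forall>v\<in>verts P. card {e \<in> hedges P. v \<in> e} \<le> d)"

definition hgp_size :: "'v hgp \<Rightarrow> nat" where
  "hgp_size P = card (hedges P)"

text \<open>
  Since hypergraphs are finite, vertices may be taken to be natural numbers. In all the minima below
  the sets are nonempty (in the monotone versions: for monotone \<open>f\<close>).
\<close>

definition HGP :: "nat \<Rightarrow> (bool list \<Rightarrow> bool) \<Rightarrow> nat" where
  "HGP n f = (LEAST s. \<exists>P :: nat hgp. hgp_computes n P f \<and> hgp_size P = s)"

definition HGP_deg :: "nat \<Rightarrow> nat \<Rightarrow> (bool list \<Rightarrow> bool) \<Rightarrow> nat" where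
  "HGP_deg d n f =
     (LEAST s. \<exists>P :: nat hgp. hgp_computes n P f \<and> hgp_degree_le d P \<and> hgp_size P = s)"

definition HGP_mono :: "nat \<Rightarrow> (bool list \<Rightarrow> bool) \<Rightarrow> nat" where
  "HGP_mono n f =
     (LEAST s. \<exists>P :: nat hgp. hgp_computes n P f \<and> hgp_mono P \<and> hgp_size P = s)"

definition HGP_deg_mono :: "nat \<Rightarrow> nat \<Rightarrow> (bool list \<Rightarrow> bool) \<Rightarrow> nat" where
  "HGP_deg_mono d n f =
     (LEAST s. \<exists>P :: nat hgp.
        hgp_computes n P f \<and> hgp_degree_le d P \<and> hgp_mono P \<and> hgp_size P = s)"


subsection \<open>Nondeterministic Boolean circuits\<close>

text \<open>
  A circuit is a topologically ordered list of gates over the basis of binary conjunction, binary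
  disjunction and negation. A wire comes from an input variable, an advice variable, a constant, or
  the gate with the given position in the list. The size is the number of gates.
\<close>

datatype wire = Input nat | Advice nat | Constant bool | Gate nat

datatype gate = NotG wire | AndG wire wire | OrG wire wire

record circuit =
  n_advice :: nat
  gates :: "gate list"
  out_wire :: wire

fun wire_ok :: "nat \<Rightarrow> nat \<Rightarrow> nat \<Rightarrow> wire \<Rightarrow> bool" where
  "wire_ok n m k (Input i) = (i < n)"
| "wire_ok n m k (Advice j) = (j < m)"
| "wire_ok n m k (Constant b) = True"
| "wire_ok n m k (Gate l) = (l < k)"

fun gate_wires :: "gate \<Rightarrow> wire set" where
  "gate_wires (NotG u) = {u}"
| "gate_wires (AndG u v) = {u, v}"
| "gate_wires (OrG u v) = {u, v}"

definition is_circuit :: "nat \<Rightarrow> circuit \<Rightarrow> bool" where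
  "is_circuit n C \<longleftrightarrow>
     (\<forall>k < length (gates C). \<forall>w \<in> gate_wires (gates C ! k). wire_ok n (n_advice C) k w) \<and>
     wire_ok n (n_advice C) (length (gates C)) (out_wire C)"

fun wire_val :: "bool list \<Rightarrow> bool list \<Rightarrow> bool list \<Rightarrow> wire \<Rightarrow> bool" where
  "wire_val \<alpha> \<beta> vs (Input i) = \<alpha> ! i"
| "wire_val \<alpha> \<beta> vs (Advice j) = \<beta> ! j"
| "wire_val \<alpha> \<beta> vs (Constant b) = b"
| "wire_val \<alpha> \<beta> vs (Gate k) = vs ! k"

fun gate_val :: "bool list \<Rightarrow> bool list \<Rightarrow> bool list \<Rightarrow> gate \<Rightarrow> bool" where
  "gate_val \<alpha> \<beta> vs (NotG u) = (\<not> wire_val \<alpha> \<beta> vs u)"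
| "gate_val \<alpha> \<beta> vs (AndG u v) = (wire_val \<alpha> \<beta> vs u \<and> wire_val \<alpha> \<beta> vs v)"
| "gate_val \<alpha> \<beta> vs (OrG u v) = (wire_val \<alpha> \<beta> vs u \<or> wire_val \<alpha> \<beta> vs v)"

definition gate_vals :: "bool list \<Rightarrow> bool list \<Rightarrow> gate list \<Rightarrow> bool list" where
  "gate_vals \<alpha> \<beta> gs = foldl (\<lambda>vs g. vs @ [gate_val \<alpha> \<beta> vs g]) [] gs"

definition circuit_val :: "circuit \<Rightarrow> bool list \<Rightarrow> bool list \<Rightarrow> bool" where
  "circuit_val C \<alpha> \<beta> = wire_val \<alpha> \<beta> (gate_vals \<alpha> \<beta> (gates C)) (out_wire C)"

definition nbc_computes :: "nat \<Rightarrow> circuit \<Rightarrow> (bool list \<Rightarrow> bool) \<Rightarrow> bool" where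
  "nbc_computes n C f \<longleftrightarrow> is_circuit n C \<and>
     (\<forall>\<alpha>. length \<alpha> = n \<longrightarrow> (f \<alpha> \<longleftrightarrow> (\<exists>\<beta>. length \<beta> = n_advice C \<and> circuit_val C \<alpha> \<beta>)))"

definition nbc_mono :: "circuit \<Rightarrow> bool" where
  "nbc_mono C \<longleftrightarrow> (\<forall>w. NotG w \<in> set (gates C) \<longrightarrow> (\<exists>j. w = Advice j))"

definition nbc_size :: "circuit \<Rightarrow> nat" where
  "nbc_size C = length (gates C)"

definition NBC :: "nat \<Rightarrow> (bool list \<Rightarrow> bool) \<Rightarrow> nat" where
  "NBC n f = (LEAST s. \<exists>C. nbc_computes n C f \<and> nbc_size C = s)"

definition NBC_mono :: "nat \<Rightarrow> (bool list \<Rightarrow> bool) \<Rightarrow> nat" where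
  "NBC_mono n f = (LEAST s. \<exists>C. nbc_computes n C f \<and> nbc_mono C \<and> nbc_size C = s)"


subsection \<open>Polynomial bounds\<close>

text \<open>
  The polynomial is uniform in the number \<open>n\<close> of variables and the function \<open>f\<close>; \<open>F\<close> delimits the
  functions considered.

  The number of hyperedges does not account for the variables occurring in a program: the conjunction
  of \<open>n\<close> variables has a program without hyperedges, but its circuits have at least \<open>n - 1\<close> gates. Upper
  bounds in terms of hyperedges therefore take \<open>n\<close> as a further argument of the polynomial; this is
  expressed by choosing \<open>\<lambda>n f. n + HGP n f\<close> for \<open>B\<close>, which is equivalent to a polynomial in \<open>n\<close> and \<open>HGP n f\<close>.
\<close>

definition poly_bounded ::
  "(nat \<Rightarrow> (bool list \<Rightarrow> bool) \<Rightarrow> bool) \<Rightarrow> (nat \<Rightarrow> (bool list \<Rightarrow> bool) \<Rightarrow> nat) \<Rightarrow>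
   (nat \<Rightarrow> (bool list \<Rightarrow> bool) \<Rightarrow> nat) \<Rightarrow> bool" where
  "poly_bounded F A B \<longleftrightarrow> (\<exists>p :: nat poly. \<forall>n f. F n f \<longrightarrow> A n f \<le> poly p (B n f))"

end

theory Submission
  imports Defs "HOL-Library.Function_Algebras"
begin

text \<open>
  From programs to circuits: guess the chosen hyperedges and check that they are disjoint and cover
  every vertex whose label is false. There may be exponentially many vertices, but for a disjoint
  family \<open>M\<close> covering a set \<open>V\<close> is the linear system \<open>(\<Sum>e\<in>M. [v \<in> e]) = 1\<close> for \<open>v \<in> V\<close>, so for each
  label it suffices to check a row basis of at most \<open>m + 1\<close> vertices, \<open>m\<close> being the number of
  hyperedges.

  From circuits to programs: describe the computation of the circuit by a 3-CNF. Each variable gets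
  two hyperedges, one per truth value, and each clause one hyperedge per literal. Vertices of degree
  at most 3 enforce that a truth value is chosen for each variable, a literal for each clause, and
  that the chosen literals are true.
\<close>

section \<open>From hypergraph programs to circuits\<close>

lemma sum_fun_apply: "(\<Sum>i\<in>A. (g i :: 'a \<Rightarrow> 'b :: comm_monoid_add)) x = (\<Sum>i\<in>A. g i x)"
  by (induction A rule: infinite_finite_induct) auto

text \<open>A vertex is turned into its row of incidences with \<open>E\<close>, extended by a
  coordinate \<open>None\<close> with constant entry 1 for the right-hand side of the linear system.
  For a disjoint \<open>M\<close> the functional \<open>\<phi>\<close> vanishes on the row of a
  vertex exactly when \<open>M\<close> covers it. The kernel of \<open>\<phi>\<close> is a subspace,
  so vanishing on a basis of the rows gives vanishing on all of them, and the rows span a space of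
  dimension at most \<open>card E + 1\<close>.\<close>

lemma disjoint_cover_basis:
  fixes E :: "'v set set"
  assumes "finite E"
  shows "\<exists>S\<subseteq>V. finite S \<and> card S \<le> card E + 1 \<and>
           (\<forall>M\<subseteq>E. disjoint M \<and> S \<subseteq> \<Union>M \<longrightarrow> V \<subseteq> \<Union>M)"
proof -
  interpret vector_space "\<lambda>(c::real) (g :: 'v set option \<Rightarrow> real) x. c * g x"
    by unfold_locales (auto simp: fun_eq_iff algebra_simps)
  let ?I = "insert None (Some ` E)"
  define \<delta> :: "'v set option \<Rightarrow> 'v set option \<Rightarrow> real" where "\<delta> = (\<lambda>i j. of_bool (i = j))"
  define r :: "'v \<Rightarrow> 'v set option \<Rightarrow> real" where
    "r = (\<lambda>v i. case i of None \<Rightarrow> 1 | Some e \<Rightarrow> of_bool (e \<in> E \<and> v \<in> e))"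
  have finI: "finite ?I" using assms by simp
  \<comment> \<open>The ambient function space may have infinite dimension. Since \<open>r v\<close>
    vanishes outside \<open>?I\<close>, finitely many unit vectors span all rows, which bounds the
    size of \<open>B\<close>.\<close>
  have "r v \<in> span (\<delta> ` ?I)" for v
  proof -
    have "r v = (\<Sum>i\<in>?I. (\<lambda>x. r v i * \<delta> i x))"
    proof
      fix x
      have "(\<Sum>i\<in>?I. (\<lambda>x. r v i * \<delta> i x)) x = (\<Sum>i\<in>?I. r v i * \<delta> i x)"
        by (rule sum_fun_apply)
      also have "\<dots> = (\<Sum>i\<in>?I. if i = x then r v x else 0)"
        by (rule sum.cong) (auto simp: \<delta>_def)
      also have "\<dots> = (if x \<in> ?I then r v x else 0)"
        by (rule sum.delta[OF finI])
      also have "\<dots> = r v x"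
        by (cases x) (auto simp: r_def)
      finally show "r v x = (\<Sum>i\<in>?I. (\<lambda>x. r v i * \<delta> i x)) x" by simp
    qed
    also have "\<dots> \<in> span (\<delta> ` ?I)"
      by (intro span_sum span_scale span_base) auto
    finally show ?thesis .
  qed
  then have span: "r ` V \<subseteq> span (\<delta> ` ?I)" by auto
  obtain B where B: "B \<subseteq> r ` V" "independent B" "r ` V \<subseteq> span B"
    using maximal_independent_subset by blast
  have "finite B \<and> card B \<le> card (\<delta> ` ?I)"
    using B span finI by (intro independent_span_bound) auto
  moreover have "card (\<delta> ` ?I) \<le> card E + 1"
  proof -
    have "card (\<delta> ` ?I) \<le> card ?I" by (rule card_image_le[OF finI])
    also have "\<dots> = card E + 1" using assms by (simp add: card_image)
    finally show ?thesis .
  qed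
  ultimately have finB: "finite B" and cardB: "card B \<le> card E + 1" by auto
  \<comment> \<open>One vertex is picked for each basis row; vertices with equal rows lie in the
    same hyperedges of \<open>E\<close>.\<close>
  define S where "S = inv_into V r ` B"
  have "S \<subseteq> V" using B(1) by (auto simp: S_def intro: inv_into_into)
  moreover have "finite S" using finB by (simp add: S_def)
  moreover have "card S \<le> card E + 1"
    using card_image_le[OF finB, of "inv_into V r"] cardB by (simp add: S_def)
  moreover have "V \<subseteq> \<Union>M" if M: "M \<subseteq> E" "disjoint M" "S \<subseteq> \<Union>M" for M
  proof -
    have finM: "finite M" using M(1) assms finite_subset by blast
    define \<phi> :: "('v set option \<Rightarrow> real) \<Rightarrow> real" where
      "\<phi> = (\<lambda>g. (\<Sum>e\<in>M. g (Some e)) - g None)"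
    have \<phi>_r: "\<phi> (r v) = real (card {e\<in>M. v \<in> e}) - 1" for v
    proof -
      have "(\<Sum>e\<in>M. r v (Some e)) = (\<Sum>e\<in>M. if v \<in> e then 1 else 0)"
        using M(1) by (intro sum.cong) (auto simp: r_def)
      also have "\<dots> = real (card {e\<in>M. v \<in> e})"
        using finM by (simp add: sum.If_cases Int_def)
      finally show ?thesis by (simp add: \<phi>_def r_def)
    qed
    \<comment> \<open>The vertex behind \<open>b\<close> is covered by \<open>M\<close>, and by
      disjointness only once, so the count in \<open>\<phi>_r\<close> is 1.\<close>
    have "\<phi> b = 0" if "b \<in> B" for b
    proof -
      let ?s = "inv_into V r b"
      have rs: "r ?s = b" using that B(1) by (auto intro: f_inv_into_f)
      have "?s \<in> \<Union>M" using that M(3) by (auto simp: S_def)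
      then obtain e where "e \<in> M" "?s \<in> e" by auto
      with M(2) have "{e\<in>M. ?s \<in> e} = {e}" by (auto simp: disjoint_def)
      then show ?thesis using \<phi>_r[of ?s] rs by simp
    qed
    then have "B \<subseteq> {g. \<phi> g = 0}" by auto
    moreover have "subspace {g. \<phi> g = 0}"
      by (auto simp: subspace_def \<phi>_def sum.distrib simp flip: sum_distrib_left)
    ultimately have "span B \<subseteq> {g. \<phi> g = 0}" by (rule span_minimal)
    with B(3) have "\<phi> (r v) = 0" if "v \<in> V" for v using that by auto
    then have "card {e\<in>M. v \<in> e} = 1" if "v \<in> V" for v using that \<phi>_r[of v] by simp
    then have "{e\<in>M. v \<in> e} \<noteq> {}" if "v \<in> V" for v
      using that by (metis card.empty zero_neq_one)
    then show ?thesis by auto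
  qed
  ultimately show ?thesis by (intro exI[of _ S]) simp
qed

section \<open>Evaluation of gate lists and its stability under appending gates\<close>

text \<open>The gate condition of \<open>is_circuit\<close>, detached from the output wire so that
  it can be maintained while a gate list grows.\<close>

definition wf_gates :: "nat \<Rightarrow> nat \<Rightarrow> gate list \<Rightarrow> bool" where
  "wf_gates n m gs \<longleftrightarrow> (\<forall>k < length gs. \<forall>w \<in> gate_wires (gs ! k). wire_ok n m k w)"

lemma gate_vals_Nil [simp]: "gate_vals \<alpha> \<beta> [] = []"
  by (simp add: gate_vals_def)

lemma gate_vals_snoc [simp]:
  "gate_vals \<alpha> \<beta> (gs @ [g]) = gate_vals \<alpha> \<beta> gs @ [gate_val \<alpha> \<beta> (gate_vals \<alpha> \<beta> gs) g]"
  by (simp add: gate_vals_def)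

lemma length_gate_vals [simp]: "length (gate_vals \<alpha> \<beta> gs) = length gs"
  by (induction gs rule: rev_induct) auto

lemma gate_vals_append_nth:
  "k < length gs \<Longrightarrow> gate_vals \<alpha> \<beta> (gs @ hs) ! k = gate_vals \<alpha> \<beta> gs ! k"
proof (induction hs rule: rev_induct)
  case (snoc h hs)
  then show ?case
    using gate_vals_snoc[of \<alpha> \<beta> "gs @ hs" h] by (simp add: nth_append del: gate_vals_snoc)
qed simp

lemma wire_val_append:
  "wire_ok n m (length gs) w \<Longrightarrow>
   wire_val \<alpha> \<beta> (gate_vals \<alpha> \<beta> (gs @ hs)) w = wire_val \<alpha> \<beta> (gate_vals \<alpha> \<beta> gs) w"
  by (cases w) (auto simp: gate_vals_append_nth)

lemma gate_val_append:
  "\<forall>w \<in> gate_wires g. wire_ok n m (length gs) w \<Longrightarrow>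
   gate_val \<alpha> \<beta> (gate_vals \<alpha> \<beta> (gs @ hs)) g = gate_val \<alpha> \<beta> (gate_vals \<alpha> \<beta> gs) g"
  by (cases g) (auto simp: wire_val_append)

text \<open>A gate reads only earlier positions, whose values do not change when later gates are
  appended. The left fold thus becomes a system of local equations, one per gate, which is the form
  that clauses can express.\<close>

lemma gate_vals_nth:
  assumes "wf_gates n m gs" "k < length gs"
  shows "gate_vals \<alpha> \<beta> gs ! k = gate_val \<alpha> \<beta> (gate_vals \<alpha> \<beta> gs) (gs ! k)"
proof -
  let ?t = "take k gs" and ?d = "drop (Suc k) gs"
  have gs: "gs = (?t @ [gs ! k]) @ ?d"
    using assms(2) by (simp add: id_take_nth_drop[symmetric])
  have len: "length ?t = k" using assms(2) by simp
  have "gate_vals \<alpha> \<beta> gs ! k = gate_vals \<alpha> \<beta> (?t @ [gs ! k]) ! k"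
    using gate_vals_append_nth[of k "?t @ [gs ! k]" \<alpha> \<beta> ?d] gs len by simp
  also have "\<dots> = gate_val \<alpha> \<beta> (gate_vals \<alpha> \<beta> ?t) (gs ! k)"
    using len by (simp add: nth_append)
  also have "\<dots> = gate_val \<alpha> \<beta> (gate_vals \<alpha> \<beta> (?t @ ([gs ! k] @ ?d))) (gs ! k)"
    using assms len by (subst gate_val_append[of _ n m]) (auto simp: wf_gates_def)
  finally show ?thesis using gs by simp
qed

lemma wire_ok_mono: "wire_ok n m k w \<Longrightarrow> k \<le> l \<Longrightarrow> wire_ok n m l w"
  by (cases w) auto

lemma wf_gates_snoc:
  "wf_gates n m gs \<Longrightarrow> \<forall>w \<in> gate_wires g. wire_ok n m (length gs) w \<Longrightarrow> wf_gates n m (gs @ [g])"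
  by (auto simp: wf_gates_def nth_append less_Suc_eq)

section \<open>Building circuits by appending gates\<close>

definition monotone_gates :: "gate list \<Rightarrow> bool" where
  "monotone_gates gs \<longleftrightarrow> (\<forall>w. NotG w \<in> set gs \<longrightarrow> (\<exists>j. w = Advice j))"

text \<open>Quantifying over an arbitrary prefix \<open>gs\<close> makes constructions composable
  without renumbering wires: each one appends its own gates \<open>hs\<close> to whatever is already
  there. Only \<open>hs\<close> counts towards the size and has to be monotone.\<close>

definition realizable ::
  "bool \<Rightarrow> nat \<Rightarrow> nat \<Rightarrow> nat \<Rightarrow> (bool list \<Rightarrow> bool list \<Rightarrow> bool) \<Rightarrow> bool" where
  "realizable mon n m s F \<longleftrightarrow>
     (\<forall>gs. wf_gates n m gs \<longrightarrow>
        (\<exists>hs w. length hs \<le> s \<and> (mon \<longrightarrow> monotone_gates hs) \<and> wf_gates n m (gs @ hs) \<and>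
           wire_ok n m (length (gs @ hs)) w \<and>
           (\<forall>\<alpha> \<beta>. wire_val \<alpha> \<beta> (gate_vals \<alpha> \<beta> (gs @ hs)) w = F \<alpha> \<beta>)))"

lemma realizable_weaken:
  assumes F: "realizable mon n m s F" and st: "s \<le> t"
  shows "realizable mon n m t F"
  unfolding realizable_def
proof (intro allI impI)
  fix gs assume "wf_gates n m gs"
  from F[unfolded realizable_def, rule_format, OF this] st
  show "\<exists>hs w. length hs \<le> t \<and> (mon \<longrightarrow> monotone_gates hs) \<and> wf_gates n m (gs @ hs) \<and>
      wire_ok n m (length (gs @ hs)) w \<and>
      (\<forall>\<alpha> \<beta>. wire_val \<alpha> \<beta> (gate_vals \<alpha> \<beta> (gs @ hs)) w = F \<alpha> \<beta>)"
    by (elim ex_forward conj_forward) auto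
qed

text \<open>Validity at position 0 excludes gate wires, so the value does not depend on the gate
  values and \<open>[]\<close> can stand in for them.\<close>

lemma realizable_wire:
  assumes "wire_ok n m 0 w"
  shows "realizable mon n m 0 (\<lambda>\<alpha> \<beta>. wire_val \<alpha> \<beta> [] w)"
proof -
  have "wire_ok n m k w" for k using assms wire_ok_mono by blast
  moreover have "wire_val \<alpha> \<beta> vs w = wire_val \<alpha> \<beta> [] w" for \<alpha> \<beta> vs using assms by (cases w) auto
  ultimately show ?thesis
    unfolding realizable_def
    by (intro allI impI exI[of _ "[]"] exI[of _ w]) (auto simp: monotone_gates_def)
qed

lemma realizable_not:
  assumes "wire_ok n m 0 w" "mon \<Longrightarrow> \<exists>j. w = Advice j"
  shows "realizable mon n m 1 (\<lambda>\<alpha> \<beta>. \<not> wire_val \<alpha> \<beta> [] w)"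
proof -
  have "wire_ok n m k w" for k using assms wire_ok_mono by blast
  moreover have "wire_val \<alpha> \<beta> (gate_vals \<alpha> \<beta> gs) w = wire_val \<alpha> \<beta> [] w" for \<alpha> \<beta> gs
    using assms by (cases w) auto
  ultimately show ?thesis
    unfolding realizable_def
    using assms(2)
    by (intro allI impI exI[of _ "[NotG w]"] exI[of _ "Gate (length gs)" for gs])
      (auto simp: monotone_gates_def nth_append intro!: wf_gates_snoc)
qed

text \<open>The gates for \<open>G\<close> are placed after those for \<open>F\<close>; the result
  wire of \<open>F\<close> survives this extension with its value, and one final gate joins the two
  results. The pair \<open>g\<close>, \<open>op\<close> treats conjunction and disjunction
  together.\<close>

lemma realizable_binary:
  assumes F: "realizable mon n m s F" and G: "realizable mon n m t G"
    and g: "g = AndG \<and> op = (\<and>) \<or> g = OrG \<and> op = (\<or>)"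
  shows "realizable mon n m (s + t + 1) (\<lambda>\<alpha> \<beta>. op (F \<alpha> \<beta>) (G \<alpha> \<beta>))"
  unfolding realizable_def
proof (intro allI impI)
  fix gs assume "wf_gates n m gs"
  from F[unfolded realizable_def, rule_format, OF this] obtain hs w where hs: "length hs \<le> s" "mon \<longrightarrow> monotone_gates hs" "wf_gates n m (gs @ hs)"
      "wire_ok n m (length (gs @ hs)) w"
      "\<And>\<alpha> \<beta>. wire_val \<alpha> \<beta> (gate_vals \<alpha> \<beta> (gs @ hs)) w = F \<alpha> \<beta>"
    by blast
  from G[unfolded realizable_def, rule_format, OF hs(3)] obtain ks u where ks: "length ks \<le> t" "mon \<longrightarrow> monotone_gates ks"
      "wf_gates n m ((gs @ hs) @ ks)" "wire_ok n m (length ((gs @ hs) @ ks)) u"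
      "\<And>\<alpha> \<beta>. wire_val \<alpha> \<beta> (gate_vals \<alpha> \<beta> ((gs @ hs) @ ks)) u = G \<alpha> \<beta>"
    by blast
  let ?gs = "(gs @ hs) @ ks"
  have w: "wire_ok n m (length ?gs) w" using hs(4) by (rule wire_ok_mono) simp
  have wf: "wf_gates n m (?gs @ [g w u])"
    using ks(3,4) w g by (intro wf_gates_snoc) auto
  have "wire_val \<alpha> \<beta> (gate_vals \<alpha> \<beta> ?gs) w = F \<alpha> \<beta>" for \<alpha> \<beta>
    using wire_val_append[OF hs(4)] hs(5) by simp
  then have "gate_vals \<alpha> \<beta> (?gs @ [g w u]) ! length ?gs = op (F \<alpha> \<beta>) (G \<alpha> \<beta>)" for \<alpha> \<beta>
    using ks(5)[of \<alpha> \<beta>] g unfolding gate_vals_snoc nth_append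
    by (auto simp del: append_assoc)
  then show "\<exists>hs w. length hs \<le> s + t + 1 \<and> (mon \<longrightarrow> monotone_gates hs) \<and> wf_gates n m (gs @ hs) \<and>
           wire_ok n m (length (gs @ hs)) w \<and>
           (\<forall>\<alpha> \<beta>. wire_val \<alpha> \<beta> (gate_vals \<alpha> \<beta> (gs @ hs)) w = op (F \<alpha> \<beta>) (G \<alpha> \<beta>))"
    using hs(1,2) ks(1,2) wf g
    by (intro exI[of _ "hs @ ks @ [g w u]"] exI[of _ "Gate (length ?gs)"])
      (auto simp: monotone_gates_def)
qed

lemmas realizable_and = realizable_binary[where g = AndG and op = "(\<and>)",
  OF _ _ disjI1[OF conjI[OF refl refl]]]
lemmas realizable_or = realizable_binary[where g = OrG and op = "(\<or>)",
  OF _ _ disjI2[OF conjI[OF refl refl]]]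

text \<open>Each element costs its own \<open>s\<close> gates and one conjunction gate; the empty
  conjunction is a constant wire.\<close>

lemma realizable_Ball:
  assumes "finite A" "\<And>a. a \<in> A \<Longrightarrow> realizable mon n m s (F a)"
  shows "realizable mon n m (card A * (s + 1)) (\<lambda>\<alpha> \<beta>. \<forall>a\<in>A. F a \<alpha> \<beta>)"
  using assms
proof (induction A)
  case empty
  then show ?case using realizable_wire[of n m "Constant True" mon] by simp
next
  case (insert a A)
  then have "realizable mon n m (s + card A * (s + 1) + 1) (\<lambda>\<alpha> \<beta>. F a \<alpha> \<beta> \<and> (\<forall>a\<in>A. F a \<alpha> \<beta>))"
    by (intro realizable_and) auto
  with insert.hyps show ?case by (simp add: algebra_simps)
qed

lemma realizable_Bex:
  assumes "finite A" "\<And>a. a \<in> A \<Longrightarrow> realizable mon n m s (F a)"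
  shows "realizable mon n m (card A * (s + 1)) (\<lambda>\<alpha> \<beta>. \<exists>a\<in>A. F a \<alpha> \<beta>)"
  using assms
proof (induction A)
  case empty
  then show ?case using realizable_wire[of n m "Constant False" mon] by simp
next
  case (insert a A)
  then have "realizable mon n m (s + card A * (s + 1) + 1) (\<lambda>\<alpha> \<beta>. F a \<alpha> \<beta> \<or> (\<exists>a\<in>A. F a \<alpha> \<beta>))"
    by (intro realizable_or) auto
  with insert.hyps show ?case by (simp add: algebra_simps)
qed

lemma realizable_label:
  assumes "label_ok n l" "mon \<Longrightarrow> \<forall>i. l \<noteq> Neg i"
  shows "realizable mon n m 1 (\<lambda>\<alpha> \<beta>. label_val \<alpha> l)"
proof (cases l)
  case (Const b)
  then show ?thesis
    using realizable_weaken[OF realizable_wire[of n m "Constant b" mon], of 1] by simp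
next
  case (Pos i)
  then show ?thesis
    using realizable_weaken[OF realizable_wire[of n m "Input i" mon], of 1] assms by simp
next
  case (Neg i)
  then show ?thesis using realizable_not[of n m "Input i" mon] assms by (cases mon) auto
qed

lemma realizable_circuit:
  assumes "realizable mon n m s F"
  shows "\<exists>C. is_circuit n C \<and> n_advice C = m \<and> nbc_size C \<le> s \<and> (mon \<longrightarrow> nbc_mono C) \<and>
           (\<forall>\<alpha> \<beta>. circuit_val C \<alpha> \<beta> = F \<alpha> \<beta>)"
proof -
  have "wf_gates n m []" by (simp add: wf_gates_def)
  then obtain hs w where "length hs \<le> s" "mon \<longrightarrow> monotone_gates hs" "wf_gates n m hs"
      "wire_ok n m (length hs) w" "\<And>\<alpha> \<beta>. wire_val \<alpha> \<beta> (gate_vals \<alpha> \<beta> hs) w = F \<alpha> \<beta>"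
    using assms unfolding realizable_def by (metis append_Nil)
  then show ?thesis
    by (intro exI[of _ "\<lparr>n_advice = m, gates = hs, out_wire = w\<rparr>"])
      (auto simp: is_circuit_def wf_gates_def nbc_size_def nbc_mono_def monotone_gates_def
        circuit_val_def)
qed

section \<open>The circuit that checks a guessed family of hyperedges\<close>

lemma card_labels_le: "L \<subseteq> Collect (label_ok n) \<Longrightarrow> finite L \<and> card L \<le> 2 * n + 2"
proof -
  assume L: "L \<subseteq> Collect (label_ok n)"
  let ?A = "Const ` UNIV \<union> (Pos ` {..<n} \<union> Neg ` {..<n})"
  have sub: "L \<subseteq> ?A"
  proof
    fix l assume "l \<in> L"
    with L show "l \<in> ?A" by (cases l) auto
  qed
  have "card (Const ` (UNIV::bool set)) \<le> 2" "card (Pos ` {..<n}) \<le> n" "card (Neg ` {..<n}) \<le> n"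
    by (auto intro: order_trans[OF card_image_le])
  then have "card ?A \<le> 2 * n + 2"
    using card_Un_le[of "Const ` (UNIV::bool set)" "Pos ` {..<n} \<union> Neg ` {..<n}"]
      card_Un_le[of "Pos ` {..<n}" "Neg ` {..<n}"] by linarith
  moreover have fin: "finite ?A" by simp
  ultimately show ?thesis using sub card_mono[OF fin sub] finite_subset[OF sub fin] by linarith
qed

text \<open>The advice bit \<open>h e\<close> tells whether the hyperedge \<open>e\<close> is
  chosen. \<open>F1\<close> checks disjointness with 4 gates per intersecting pair and negates
  advice bits only; \<open>F2\<close> checks coverage of at most
  \<open>(2 * n + 2) * (m + 1)\<close> vertices with \<open>m + 3\<close> gates each and negates an
  input only for a negated label. The last gate joins both checks.\<close>

lemma hgp_to_nbc:
  assumes comp: "hgp_computes n P f"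
  shows "\<exists>C. nbc_computes n C f \<and> (hgp_mono P \<longrightarrow> nbc_mono C) \<and>
           nbc_size C \<le> 4 * hgp_size P * hgp_size P +
             (2 * n + 2) * (hgp_size P + 1) * (hgp_size P + 3) + 1"
proof -
  let ?V = "verts P" and ?E = "hedges P"
  define m where "m = card ?E"
  from comp have hgp: "is_hgp n P" and f: "\<And>\<alpha>. length \<alpha> = n \<Longrightarrow> f \<alpha> = hgp_accepts P \<alpha>"
    by (auto simp: hgp_computes_def)
  have finV: "finite ?V" and EV: "?E \<subseteq> Pow ?V" and ok: "\<And>v. v \<in> ?V \<Longrightarrow> label_ok n (lab P v)"
    using hgp by (auto simp: is_hgp_def)
  have finE: "finite ?E" using EV finV finite_subset by blast
  obtain h where "bij_betw h ?E {0..<m}" using ex_bij_betw_finite_nat[OF finE] by (auto simp: m_def)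
  then have inj: "inj_on h ?E" and hm: "\<And>e. e \<in> ?E \<Longrightarrow> h e < m"
    by (auto simp: bij_betw_def)
  \<comment> \<open>The basis is taken separately for each label because, for every input, the
    vertices to be covered form a union of whole label classes.\<close>
  have "\<exists>T. \<forall>l. T l \<subseteq> {v\<in>?V. lab P v = l} \<and> finite (T l) \<and> card (T l) \<le> m + 1 \<and>
     (\<forall>M\<subseteq>?E. disjoint M \<and> T l \<subseteq> \<Union>M \<longrightarrow> {v\<in>?V. lab P v = l} \<subseteq> \<Union>M)"
    unfolding m_def by (intro choice allI disjoint_cover_basis[OF finE])
  then obtain T where T': "\<forall>l. T l \<subseteq> {v\<in>?V. lab P v = l} \<and> finite (T l) \<and> card (T l) \<le> m + 1 \<and>
     (\<forall>M\<subseteq>?E. disjoint M \<and> T l \<subseteq> \<Union>M \<longrightarrow> {v\<in>?V. lab P v = l} \<subseteq> \<Union>M)"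
    by (rule exE)
  have T: "T l \<subseteq> {v\<in>?V. lab P v = l}" "finite (T l)" "card (T l) \<le> m + 1" for l
    using T'[rule_format, of l] by auto
  have T_cover: "{v\<in>?V. lab P v = l} \<subseteq> \<Union>M" if "M \<subseteq> ?E" "disjoint M" "T l \<subseteq> \<Union>M" for l M
    using T'[THEN spec, of l, THEN conjunct2, THEN conjunct2, THEN conjunct2] that by simp
  define L where "L = lab P ` ?V"
  have L: "finite L" "card L \<le> 2 * n + 2" using card_labels_le[of L n] ok by (auto simp: L_def)
  define S where "S = (\<Union>l\<in>L. T l)"
  have finS: "finite S" using L T(2) by (simp add: S_def)
  have "card S \<le> (\<Sum>l\<in>L. card (T l))" unfolding S_def by (rule card_UN_le[OF L(1)])
  also have "\<dots> \<le> card L * (m + 1)" using sum_bounded_above[of L "\<lambda>l. card (T l)" "m + 1"] T(3) by simp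
  also have "\<dots> \<le> (2 * n + 2) * (m + 1)" using L(2) by (rule mult_le_mono1)
  finally have cardS: "card S \<le> (2 * n + 2) * (m + 1)" .
  have SV: "S \<subseteq> ?V" using T(1) by (auto simp: S_def)
  define Q where "Q = {(d, e). d \<in> ?E \<and> e \<in> ?E \<and> d \<noteq> e \<and> d \<inter> e \<noteq> {}}"
  have QE: "Q \<subseteq> ?E \<times> ?E" by (auto simp: Q_def)
  have finQ: "finite Q" using QE finE finite_subset by blast
  have cardQ: "card Q \<le> m * m"
    using card_mono[OF _ QE] finE by (simp add: m_def card_cartesian_product)
  define F1 where "F1 = (\<lambda>(\<alpha>::bool list) \<beta>. \<forall>q\<in>Q. \<not> \<beta> ! h (fst q) \<or> \<not> \<beta> ! h (snd q))"
  define F2 where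
    "F2 = (\<lambda>\<alpha> \<beta>. \<forall>v\<in>S. label_val \<alpha> (lab P v) \<or> (\<exists>e\<in>{e\<in>?E. v \<in> e}. \<beta> ! h e))"
  have neg: "realizable mon n m 1 (\<lambda>\<alpha> \<beta>. \<not> \<beta> ! h e)" if "e \<in> ?E" for e mon
    using realizable_not[of n m "Advice (h e)" mon] hm[OF that] by simp
  have pos: "realizable mon n m 0 (\<lambda>\<alpha> \<beta>. \<beta> ! h e)" if "e \<in> ?E" for e mon
    using realizable_wire[of n m "Advice (h e)" mon] hm[OF that] by simp
  have "realizable mon n m (card Q * (1 + 1 + 1 + 1)) F1" for mon
    unfolding F1_def by (intro realizable_Ball realizable_or neg finQ) (use QE in auto)
  then have F1: "realizable mon n m (4 * m * m) F1" for mon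
    by (rule realizable_weaken) (use cardQ in simp)
  have "realizable (hgp_mono P) n m (card S * ((1 + m * (0 + 1) + 1) + 1)) F2"
    unfolding F2_def
  proof (intro realizable_Ball realizable_or finS realizable_label)
    fix v assume "v \<in> S"
    then have v: "v \<in> ?V" using SV by auto
    then show "label_ok n (lab P v)" by (rule ok)
    show "\<forall>i. lab P v \<noteq> Neg i" if "hgp_mono P" using that v by (auto simp: hgp_mono_def)
    have "card {e\<in>?E. v \<in> e} \<le> m" unfolding m_def using finE by (intro card_mono) auto
    then show "realizable (hgp_mono P) n m (m * (0 + 1)) (\<lambda>\<alpha> \<beta>. \<exists>e\<in>{e\<in>?E. v \<in> e}. \<beta> ! h e)"
      using finE by (intro realizable_weaken[OF realizable_Bex[where s = 0]] pos) auto
  qed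
  then have F2: "realizable (hgp_mono P) n m ((2 * n + 2) * (m + 1) * (m + 3)) F2"
    by (rule realizable_weaken) (use mult_le_mono1[OF cardS, of "m + 3"] in \<open>simp add: algebra_simps\<close>)
  from realizable_circuit[OF realizable_and[OF F1 F2]]
  obtain C where C: "is_circuit n C" "n_advice C = m"
      "nbc_size C \<le> 4 * m * m + (2 * n + 2) * (m + 1) * (m + 3) + 1" "hgp_mono P \<longrightarrow> nbc_mono C"
      "\<And>\<alpha> \<beta>. circuit_val C \<alpha> \<beta> = (F1 \<alpha> \<beta> \<and> F2 \<alpha> \<beta>)"
    by blast
  have "hgp_accepts P \<alpha> \<longleftrightarrow> (\<exists>\<beta>. length \<beta> = m \<and> F1 \<alpha> \<beta> \<and> F2 \<alpha> \<beta>)" for \<alpha>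
  proof
    assume "hgp_accepts P \<alpha>"
    then obtain M where M: "M \<subseteq> ?E" "disjoint M" "{v \<in> ?V. \<not> label_val \<alpha> (lab P v)} \<subseteq> \<Union>M"
      by (auto simp: hgp_accepts_def)
    \<comment> \<open>The characteristic list of \<open>M\<close> under the numbering
      \<open>h\<close>.\<close>
    define \<beta> where "\<beta> = map (\<lambda>j. j \<in> h ` M) [0..<m]"
    have \<beta>: "\<beta> ! h e \<longleftrightarrow> e \<in> M" if "e \<in> ?E" for e
      using that M(1) hm inj by (auto simp: \<beta>_def inj_on_def)
    have "F1 \<alpha> \<beta>" using M(2) \<beta> by (auto simp: F1_def Q_def disjoint_def)
    moreover have "F2 \<alpha> \<beta>"
      unfolding F2_def
    proof (intro ballI disjCI)
      fix v assume v: "v \<in> S" "\<not> (\<exists>e\<in>{e\<in>?E. v \<in> e}. \<beta> ! h e)"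
      then have "v \<notin> \<Union>M" using M(1) \<beta> by auto
      then show "label_val \<alpha> (lab P v)" using M(3) SV v(1) by auto
    qed
    ultimately show "\<exists>\<beta>. length \<beta> = m \<and> F1 \<alpha> \<beta> \<and> F2 \<alpha> \<beta>" by (intro exI[of _ \<beta>]) (simp add: \<beta>_def)
  next
    assume "\<exists>\<beta>. length \<beta> = m \<and> F1 \<alpha> \<beta> \<and> F2 \<alpha> \<beta>"
    then obtain \<beta> where \<beta>: "F1 \<alpha> \<beta>" "F2 \<alpha> \<beta>" by blast
    define M where "M = {e\<in>?E. \<beta> ! h e}"
    have M: "M \<subseteq> ?E" "disjoint M" using \<beta>(1) by (auto simp: M_def F1_def Q_def disjoint_def)
    have "v \<in> \<Union>M" if v: "v \<in> ?V" "\<not> label_val \<alpha> (lab P v)" for v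
    proof -
      \<comment> \<open>The vertex \<open>v\<close> itself may lie outside \<open>S\<close>, but the
        basis of its label class lies in \<open>S\<close> and carries the same false label. So
        \<open>F2\<close> covers that basis and \<open>T_cover\<close> extends the coverage to
        \<open>v\<close>.\<close>
      have "T (lab P v) \<subseteq> \<Union>M"
      proof
        fix u assume u: "u \<in> T (lab P v)"
        then have "u \<in> S" using v by (auto simp: S_def L_def)
        moreover have "lab P u = lab P v" using u T(1) by auto
        ultimately show "u \<in> \<Union>M" using \<beta>(2) v by (auto simp: F2_def M_def)
      qed
      from T_cover[OF M this] v show ?thesis by auto
    qed
    then show "hgp_accepts P \<alpha>" 
      unfolding hgp_accepts_def using M by (intro exI[of _ M] conjI subsetI) auto
  qed
  then have "nbc_computes n C f" unfolding nbc_computes_def by (simp add: C f)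
  with C(3,4) show ?thesis unfolding hgp_size_def m_def[symmetric] by blast
qed


section \<open>From circuits to hypergraph programs of degree 3\<close>

text \<open>This is the dual view of a hypergraph: elements of \<open>X\<close> become hyperedges,
  and a constraint \<open>(T, l)\<close> becomes a vertex with label \<open>l\<close> lying in
  precisely the hyperedges of the elements of \<open>T\<close>. Disjointness then says that at most
  one element of \<open>T\<close> is selected, and coverage that at least one is selected when
  \<open>l\<close> is false. The degree of the vertex is bounded by the size of
  \<open>T\<close>.\<close>

lemma constraints_to_hgp:
  fixes X :: "'x set" and K :: "('x set \<times> label) set"
  assumes finX: "finite X" and finK: "finite K"
    and K: "\<And>T l. (T, l) \<in> K \<Longrightarrow> T \<subseteq> X \<and> label_ok n l"
  shows "\<exists>P :: nat hgp. is_hgp n P \<and> hgp_size P = card X \<and>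
           ((\<forall>k\<in>K. card (fst k) \<le> 3) \<longrightarrow> hgp_degree_le 3 P) \<and>
           ((\<forall>k\<in>K. \<forall>i. snd k \<noteq> Neg i) \<longrightarrow> hgp_mono P) \<and>
           (\<forall>\<alpha>. hgp_accepts P \<alpha> \<longleftrightarrow>
              (\<exists>Y\<subseteq>X. \<forall>k\<in>K. (\<forall>x\<in>Y \<inter> fst k. \<forall>y\<in>Y \<inter> fst k. x = y) \<and>
                 (\<not> label_val \<alpha> (snd k) \<longrightarrow> Y \<inter> fst k \<noteq> {})))"
proof -
  \<comment> \<open>The singleton constraints are vacuous; they make distinct elements of X distinct hyperedges.\<close>
  define K' where "K' = K \<union> (\<lambda>x. ({x}, Const True)) ` X"
  have "finite K'" using finX finK by (simp add: K'_def)
  \<comment> \<open>Vertices have to be natural numbers, so a constraint is represented by its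
    positions in a list.\<close>
  then obtain ks where ks: "set ks = K'" using finite_list by blast
  define E where "E = (\<lambda>x. {i. i < length ks \<and> x \<in> fst (ks ! i)})"
  define P :: "nat hgp" where
    "P = \<lparr>verts = {..<length ks}, hedges = E ` X, lab = (\<lambda>i. snd (ks ! i))\<rparr>"
  have nthK: "ks ! i \<in> K'" if "i < length ks" for i using that ks by auto
  have Kidx: "\<exists>i < length ks. ks ! i = k" if "k \<in> K'" for k using that ks by (auto simp: in_set_conv_nth)
  have K': "fst k \<subseteq> X \<and> label_ok n (snd k)" if "k \<in> K'" for k
    using that K[of "fst k" "snd k"] by (auto simp: K'_def)
  have inj: "inj_on E X"
  proof (rule inj_onI)
    fix x y assume x: "x \<in> X" and y: "y \<in> X" and eq: "E x = E y"
    from x have "({x}, Const True) \<in> K'" by (auto simp: K'_def)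
    from Kidx[OF this] obtain i where i: "i < length ks" "ks ! i = ({x}, Const True)" by auto
    then have "i \<in> E x" by (simp add: E_def)
    with eq have "i \<in> E y" by simp
    with i show "x = y" by (simp add: E_def)
  qed
  have "is_hgp n P" using nthK K' by (auto simp: is_hgp_def P_def E_def)
  moreover have "hgp_size P = card X" using inj by (simp add: hgp_size_def P_def card_image)
  moreover have "hgp_degree_le 3 P" if deg: "\<forall>k\<in>K. card (fst k) \<le> 3"
    unfolding hgp_degree_le_def
  proof
    fix i assume "i \<in> verts P"
    then have i: "i < length ks" by (simp add: P_def)
    have "{e \<in> hedges P. i \<in> e} \<subseteq> E ` fst (ks ! i)" by (auto simp: P_def E_def)
    moreover have fin: "finite (fst (ks ! i))" using K'[OF nthK[OF i]] finX finite_subset by blast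
    ultimately have "card {e \<in> hedges P. i \<in> e} \<le> card (fst (ks ! i))"
      by (meson card_image_le card_mono finite_imageI order_trans)
    also have "\<dots> \<le> 3" using nthK[OF i] deg by (auto simp: K'_def)
    finally show "card {e \<in> hedges P. i \<in> e} \<le> 3" .
  qed
  moreover have "hgp_mono P" if "\<forall>k\<in>K. \<forall>i. snd k \<noteq> Neg i"
  proof -
    have "\<forall>k\<in>K'. \<forall>i. snd k \<noteq> Neg i" using that by (auto simp: K'_def)
    then show ?thesis using nthK by (simp add: hgp_mono_def P_def)
  qed
  moreover have "hgp_accepts P \<alpha> \<longleftrightarrow>
      (\<exists>Y\<subseteq>X. \<forall>k\<in>K. (\<forall>x\<in>Y \<inter> fst k. \<forall>y\<in>Y \<inter> fst k. x = y) \<and>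
         (\<not> label_val \<alpha> (snd k) \<longrightarrow> Y \<inter> fst k \<noteq> {}))" (is "_ = ?R") for \<alpha>
  proof
    assume "hgp_accepts P \<alpha>"
    then obtain M where M: "M \<subseteq> E ` X" "disjoint M"
        "{i \<in> verts P. \<not> label_val \<alpha> (lab P i)} \<subseteq> \<Union>M"
      by (auto simp: hgp_accepts_def P_def)
    from M(1) obtain Y where Y: "Y \<subseteq> X" "M = E ` Y" by (auto simp: subset_image_iff)
    show ?R
    proof (intro exI[of _ Y] conjI ballI impI Y(1))
      fix k x y assume k: "k \<in> K" and x: "x \<in> Y \<inter> fst k" and y: "y \<in> Y \<inter> fst k"
      from k have "k \<in> K'" by (simp add: K'_def)
      from Kidx[OF this] obtain i where i: "i < length ks" "ks ! i = k" by auto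
      then have "i \<in> E x \<inter> E y" using x y by (simp add: E_def)
      moreover have "E x \<in> M" "E y \<in> M" using x y Y(2) by auto
      ultimately have "E x = E y" using M(2) unfolding disjoint_def by (metis empty_iff)
      with inj show "x = y" using x y Y(1) by (auto dest: inj_onD)
    next
      fix k assume k: "k \<in> K" and l: "\<not> label_val \<alpha> (snd k)"
      from k have "k \<in> K'" by (simp add: K'_def)
      from Kidx[OF this] obtain i where i: "i < length ks" "ks ! i = k" by auto
      then have "i \<in> \<Union>M" using M(3) l by (auto simp: P_def)
      then show "Y \<inter> fst k \<noteq> {}" using i Y(2) by (auto simp: E_def)
    qed
  next
    assume ?R
    then obtain Y where Y: "Y \<subseteq> X"
        "\<And>k x y. k \<in> K \<Longrightarrow> x \<in> Y \<inter> fst k \<Longrightarrow> y \<in> Y \<inter> fst k \<Longrightarrow> x = y"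
        "\<And>k. k \<in> K \<Longrightarrow> \<not> label_val \<alpha> (snd k) \<Longrightarrow> Y \<inter> fst k \<noteq> {}"
      by metis
    show "hgp_accepts P \<alpha>"
      unfolding hgp_accepts_def
    proof (intro exI[of _ "E ` Y"] conjI)
      show "E ` Y \<subseteq> hedges P" using Y(1) by (auto simp: P_def)
      show "disjoint (E ` Y)"
      proof (rule disjointI)
        fix a b assume "a \<in> E ` Y" "b \<in> E ` Y" "a \<noteq> b"
        then obtain x y where xy: "x \<in> Y" "y \<in> Y" "a = E x" "b = E y" "x \<noteq> y" by auto
        have False if "i \<in> E x" "i \<in> E y" for i
        proof -
          from that have i: "i < length ks" "x \<in> fst (ks ! i)" "y \<in> fst (ks ! i)"
            by (auto simp: E_def)
          \<comment> \<open>A constraint containing two different elements is not one of the added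
            singletons.\<close>
          from nthK[OF i(1)] i(2,3) xy(5) have "ks ! i \<in> K" by (auto simp: K'_def)
          from Y(2)[OF this] i xy show False by auto
        qed
        then show "a \<inter> b = {}" using xy by auto
      qed
      show "{v \<in> verts P. \<not> label_val \<alpha> (lab P v)} \<subseteq> \<Union> (E ` Y)"
      proof
        fix i assume "i \<in> {v \<in> verts P. \<not> label_val \<alpha> (lab P v)}"
        then have i: "i < length ks" "\<not> label_val \<alpha> (snd (ks ! i))" by (auto simp: P_def)
        with nthK[OF i(1)] have "ks ! i \<in> K" by (auto simp: K'_def)
        from Y(3)[OF this i(2)] i(1) show "i \<in> \<Union> (E ` Y)" by (auto simp: E_def)
      qed
    qed
  qed
  ultimately show ?thesis by (intro exI[of _ P]) simp
qed

section \<open>Formulas in 3-CNF as programs of degree 3\<close>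

text \<open>The label acts as one more literal, evaluated on the input instead of the assignment;
  \<open>Const False\<close> gives an ordinary clause.\<close>

definition sat_clause ::
  "bool list \<Rightarrow> ('x \<Rightarrow> bool) \<Rightarrow> ('x \<times> bool) set \<times> label \<Rightarrow> bool" where
  "sat_clause \<alpha> \<sigma> c \<longleftrightarrow> label_val \<alpha> (snd c) \<or> (\<exists>(x, b)\<in>fst c. \<sigma> x = b)"

text \<open>\<open>Val x b\<close> assigns the value \<open>b\<close> to \<open>x\<close>; \<open>Wit c l\<close> selects \<open>l\<close> as a true literal of \<open>c\<close>.\<close>

datatype 'x choice = Val 'x bool | Wit "('x \<times> bool) set \<times> label" "'x \<times> bool"

text \<open>The input enters only through the labels of the clause vertices: a clause whose label is
  true may go without a selected literal. The size comes from two choices per occurring variable and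
  one per literal occurrence, hence at most three times the number of occurrences, which is at most
  \<open>3 * card \<C>\<close>.\<close>

lemma cnf_to_hgp:
  fixes \<C> :: "(('x \<times> bool) set \<times> label) set"
  assumes fin: "finite \<C>"
    and C: "\<And>c. c \<in> \<C> \<Longrightarrow> finite (fst c) \<and> card (fst c) \<le> 3 \<and> label_ok n (snd c)"
  shows "\<exists>P :: nat hgp. is_hgp n P \<and> hgp_size P \<le> 9 * card \<C> \<and> hgp_degree_le 3 P \<and>
           ((\<forall>c\<in>\<C>. \<forall>i. snd c \<noteq> Neg i) \<longrightarrow> hgp_mono P) \<and>
           (\<forall>\<alpha>. hgp_accepts P \<alpha> \<longleftrightarrow> (\<exists>\<sigma>. \<forall>c\<in>\<C>. sat_clause \<alpha> \<sigma> c))"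
proof -
  define L where "L = Sigma \<C> fst"
  \<comment> \<open>Only variables that occur in a clause get hyperedges, which keeps
    \<open>X\<close> finite and linear in \<open>card \<C>\<close>.\<close>
  define U where "U = (\<lambda>(c, x, b). x) ` L"
  define X where "X = (\<lambda>(x, b). Val x b) ` (U \<times> UNIV) \<union> (\<lambda>(c, l). Wit c l) ` L"
  \<comment> \<open>Three kinds of constraints: exactly one value per variable (label false), a
    selected literal per clause (required when the label of the clause is false), and the conflict
    between a selected literal and the opposite value (label true, so no coverage is
    demanded).\<close>
  define K where "K = (\<lambda>x. (Val x ` UNIV, Const False)) ` U \<union> (\<lambda>c. (Wit c ` fst c, snd c)) ` \<C> \<union>
     (\<lambda>(c, x, b). ({Wit c (x, b), Val x (\<not> b)}, Const True)) ` L"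
  have finL: "finite L" unfolding L_def using fin C by (intro finite_SigmaI) auto
  have finU: "finite U" using finL by (simp add: U_def)
  have "card L = (\<Sum>c\<in>\<C>. card (fst c))" unfolding L_def using fin C by (intro card_SigmaI) auto
  also have "\<dots> \<le> 3 * card \<C>"
    using sum_bounded_above[of \<C> "\<lambda>c. card (fst c)" 3] C by (simp add: mult.commute)
  finally have cardL: "card L \<le> 3 * card \<C>" .
  have cardU: "card U \<le> card L" unfolding U_def by (rule card_image_le[OF finL])
  have finX: "finite X" using finU finL by (simp add: X_def)
  have "card X \<le> card ((\<lambda>(x, b). Val x b) ` (U \<times> (UNIV :: bool set))) + card ((\<lambda>(c, l). Wit c l) ` L)"
    unfolding X_def by (rule card_Un_le)
  also have "\<dots> \<le> card (U \<times> (UNIV :: bool set)) + card L"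
    using finU finL by (intro add_mono card_image_le) auto
  also have "\<dots> \<le> 9 * card \<C>" using cardU cardL by (simp add: card_cartesian_product)
  finally have cardX: "card X \<le> 9 * card \<C>" .
  have finK: "finite K" using finU finL fin by (simp add: K_def)
  have K: "T \<subseteq> X \<and> label_ok n l" if "(T, l) \<in> K" for T l
    using that C by (auto simp: K_def X_def U_def L_def image_iff split: prod.splits) (force | blast)+
  have deg: "\<forall>k\<in>K. card (fst k) \<le> 3"
  proof
    fix k assume "k \<in> K"
    then consider x where "fst k = Val x ` UNIV" | c where "c \<in> \<C>" "fst k = Wit c ` fst c"
      | c x b where "fst k = {Wit c (x, b), Val x (\<not> b)}"
      by (auto simp: K_def)
    then show "card (fst k) \<le> 3"
    proof cases
      case 1
      then show ?thesis using card_image_le[of "UNIV :: bool set" "Val x"] by simp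
    next
      case 2
      then show ?thesis using C[of c] card_image_le[of "fst c" "Wit c"] by auto
    next
      case 3
      then show ?thesis by (simp add: card_insert_if)
    qed
  qed
  from constraints_to_hgp[of X K n, OF finX finK K] deg obtain P :: "nat hgp" where
    P: "is_hgp n P" "hgp_size P = card X" "hgp_degree_le 3 P"
      "(\<forall>k\<in>K. \<forall>i. snd k \<noteq> Neg i) \<longrightarrow> hgp_mono P"
      "\<And>\<alpha>. hgp_accepts P \<alpha> \<longleftrightarrow>
              (\<exists>Y\<subseteq>X. \<forall>k\<in>K. (\<forall>x\<in>Y \<inter> fst k. \<forall>y\<in>Y \<inter> fst k. x = y) \<and>
                 (\<not> label_val \<alpha> (snd k) \<longrightarrow> Y \<inter> fst k \<noteq> {}))"
    by auto
  have "hgp_mono P" if "\<forall>c\<in>\<C>. \<forall>i. snd c \<noteq> Neg i"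
    using P(4) that by (auto simp: K_def)
  moreover have "hgp_accepts P \<alpha> \<longleftrightarrow> (\<exists>\<sigma>. \<forall>c\<in>\<C>. sat_clause \<alpha> \<sigma> c)" for \<alpha>
  proof
    assume "hgp_accepts P \<alpha>"
    then obtain Y where Y: "\<And>k x y. k \<in> K \<Longrightarrow> x \<in> Y \<inter> fst k \<Longrightarrow> y \<in> Y \<inter> fst k \<Longrightarrow> x = y"
        "\<And>k. k \<in> K \<Longrightarrow> \<not> label_val \<alpha> (snd k) \<Longrightarrow> Y \<inter> fst k \<noteq> {}"
      unfolding P(5) by metis
    define \<sigma> where "\<sigma> = (\<lambda>x. Val x True \<in> Y)"
    have "sat_clause \<alpha> \<sigma> c" if c: "c \<in> \<C>" for c
    proof (cases "label_val \<alpha> (snd c)")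
      case False
      have "(Wit c ` fst c, snd c) \<in> K" using c by (auto simp: K_def)
      from Y(2)[OF this] False obtain x b where xb: "(x, b) \<in> fst c" "Wit c (x, b) \<in> Y" by auto
      have l: "(c, x, b) \<in> L" using c xb by (simp add: L_def)
      then have "({Wit c (x, b), Val x (\<not> b)}, Const True) \<in> K"
        unfolding K_def by (intro UnI2 rev_image_eqI[OF l]) simp
      from Y(1)[OF this, of "Wit c (x, b)" "Val x (\<not> b)"] xb(2) have nb: "Val x (\<not> b) \<notin> Y" by auto
      have "x \<in> U" unfolding U_def using l by (rule rev_image_eqI) simp
      then have "(Val x ` UNIV, Const False) \<in> K" by (auto simp: K_def)
      \<comment> \<open>The selected literal has ruled out the opposite value, and some value of
        \<open>x\<close> must be chosen.\<close>
      from Y(2)[OF this] nb have "Val x b \<in> Y" by (cases b) (auto simp: UNIV_bool)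
      with nb have "\<sigma> x = b" by (cases b) (auto simp: \<sigma>_def)
      with xb show ?thesis by (auto simp: sat_clause_def)
    qed (simp add: sat_clause_def)
    then show "\<exists>\<sigma>. \<forall>c\<in>\<C>. sat_clause \<alpha> \<sigma> c" by blast
  next
    assume "\<exists>\<sigma>. \<forall>c\<in>\<C>. sat_clause \<alpha> \<sigma> c"
    then obtain \<sigma> where \<sigma>: "\<And>c. c \<in> \<C> \<Longrightarrow> sat_clause \<alpha> \<sigma> c" by blast
    define G where "G = (\<lambda>c :: ('x \<times> bool) set \<times> label. {l \<in> fst c. \<sigma> (fst l) = snd l})"
    define w where "w = (\<lambda>c. SOME l. l \<in> G c)"
    have w: "w c \<in> G c" if "G c \<noteq> {}" for c using that some_in_eq[of "G c"] by (simp add: w_def)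
    \<comment> \<open>\<open>w c\<close> is an arbitrary literal of \<open>c\<close> true under
      \<open>\<sigma>\<close>. A clause that holds only because of its label has empty
      \<open>G c\<close> and receives no selected literal.\<close>
    define Y where "Y = (\<lambda>x. Val x (\<sigma> x)) ` U \<union> (\<lambda>c. Wit c (w c)) ` {c\<in>\<C>. G c \<noteq> {}}"
    have "Y \<subseteq> X"
    proof
      fix y assume "y \<in> Y"
      then show "y \<in> X"
      proof (unfold Y_def, elim UnE imageE)
        fix x assume "y = Val x (\<sigma> x)" "x \<in> U"
        then show ?thesis by (auto simp: X_def)
      next
        fix c assume "y = Wit c (w c)" "c \<in> {c\<in>\<C>. G c \<noteq> {}}"
        moreover from this have "(c, w c) \<in> L" using w[of c] by (simp add: L_def G_def)
        ultimately show ?thesis unfolding X_def by (intro UnI2 rev_image_eqI[of "(c, w c)"]) auto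
      qed
    qed
    moreover have "(\<forall>x\<in>Y \<inter> fst k. \<forall>y\<in>Y \<inter> fst k. x = y) \<and>
        (\<not> label_val \<alpha> (snd k) \<longrightarrow> Y \<inter> fst k \<noteq> {})" if "k \<in> K" for k
    proof -
      from that consider x where "x \<in> U" "k = (Val x ` UNIV, Const False)"
        | c where "c \<in> \<C>" "k = (Wit c ` fst c, snd c)"
        | c x b where "c \<in> \<C>" "k = ({Wit c (x, b), Val x (\<not> b)}, Const True)"
        by (auto simp: K_def L_def)
      then show ?thesis
      proof cases
        case 1
        then have "Y \<inter> fst k = {Val x (\<sigma> x)}" by (auto simp: Y_def)
        then show ?thesis by simp
      next
        case 2
        then have sub: "Y \<inter> fst k \<subseteq> {Wit c (w c)}" by (auto simp: Y_def)
        have "Wit c (w c) \<in> Y \<inter> fst k" if "\<not> label_val \<alpha> (snd k)"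
        proof -
          from that \<sigma>[OF 2(1)] 2(2) have ne: "G c \<noteq> {}" by (auto simp: sat_clause_def G_def)
          with w[OF ne] 2 show ?thesis by (auto simp: Y_def G_def)
        qed
        with sub show ?thesis by auto
      next
        case 3
        have False if "Wit c (x, b) \<in> Y" "Val x (\<not> b) \<in> Y"
        proof -
          from that have "G c \<noteq> {}" "w c = (x, b)" "\<sigma> x = (\<not> b)" by (auto simp: Y_def)
          with w[of c] show False by (auto simp: G_def)
        qed
        with 3 show ?thesis by auto
      qed
    qed
    ultimately show "hgp_accepts P \<alpha>" unfolding P(5) by blast
  qed
  ultimately show ?thesis using P(1-3) cardX by (intro exI[of _ P]) simp
qed

section \<open>Circuit computations as satisfying assignments\<close>

fun gate_sem :: "(wire \<Rightarrow> bool) \<Rightarrow> gate \<Rightarrow> bool" where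
  "gate_sem \<sigma> (NotG u) = (\<not> \<sigma> u)"
| "gate_sem \<sigma> (AndG u v) = (\<sigma> u \<and> \<sigma> v)"
| "gate_sem \<sigma> (OrG u v) = (\<sigma> u \<or> \<sigma> v)"

lemma gate_val_eq_sem: "gate_val \<alpha> \<beta> vs g = gate_sem (wire_val \<alpha> \<beta> vs) g"
  by (cases g) auto

text \<open>The Tseitin clauses for the equivalence of \<open>z\<close> with the output of the
  gate.\<close>

fun gate_clauses :: "wire \<Rightarrow> gate \<Rightarrow> (wire \<times> bool) set set" where
  "gate_clauses z (NotG u) = {{(z, False), (u, False)}, {(z, True), (u, True)}}"
| "gate_clauses z (AndG u v) =
     {{(z, False), (u, True)}, {(z, False), (v, True)}, {(z, True), (u, False), (v, False)}}"
| "gate_clauses z (OrG u v) =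
     {{(z, True), (u, False)}, {(z, True), (v, False)}, {(z, False), (u, True), (v, True)}}"

lemma gate_clauses_sat:
  "(\<forall>c\<in>gate_clauses z g. sat_clause \<alpha> \<sigma> (c, Const False)) \<longleftrightarrow> \<sigma> z = gate_sem \<sigma> g"
  by (cases g) (auto simp: sat_clause_def)

lemma card_insert_le_Suc: "finite A \<Longrightarrow> card A \<le> k \<Longrightarrow> card (insert a A) \<le> Suc k"
  by (simp add: card_insert_if)

lemma gate_clauses_card:
  "finite (gate_clauses z g)" "card (gate_clauses z g) \<le> 3"
  "c \<in> gate_clauses z g \<Longrightarrow> finite c \<and> card c \<le> 3"
  by (cases g; auto simp: numeral_3_eq_3 intro!: card_insert_le_Suc)+

text \<open>The clause labelled \<open>Pos i\<close> lets the guessed input be true only where the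
  actual one is; the clause labelled \<open>Neg i\<close> is the converse and is dropped in the
  monotone case. Constants are propositional variables too and are fixed by unit clauses; advice
  wires stay free, and gate wires are governed by \<open>gate_clauses\<close>.\<close>

fun wire_clauses :: "bool \<Rightarrow> wire \<Rightarrow> ((wire \<times> bool) set \<times> label) set" where
  "wire_clauses mon (Input i) =
     insert ({(Input i, False)}, Pos i) (if mon then {} else {({(Input i, True)}, Neg i)})"
| "wire_clauses mon (Constant b) = {({(Constant b, b)}, Const False)}"
| "wire_clauses mon (Advice j) = {}"
| "wire_clauses mon (Gate k) = {}"

lemma wire_clauses_card:
  "finite (wire_clauses mon w)" "card (wire_clauses mon w) \<le> 2"
  "c \<in> wire_clauses mon w \<Longrightarrow> finite (fst c) \<and> card (fst c) \<le> 3"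
  by (cases w; auto simp: card_insert_if split: if_splits)+

lemma gate_wires_card: "finite (gate_wires g)" "card (gate_wires g) \<le> 2"
  by (cases g; auto simp: card_insert_if)+

lemma card_UN_bounded:
  assumes "finite A" "\<And>a. a \<in> A \<Longrightarrow> card (B a) \<le> k"
  shows "card (\<Union>a\<in>A. B a) \<le> card A * k"
proof -
  have "card (\<Union>a\<in>A. B a) \<le> (\<Sum>a\<in>A. card (B a))" by (rule card_UN_le[OF assms(1)])
  also have "\<dots> \<le> card A * k" using sum_bounded_above[of A "\<lambda>a. card (B a)" k] assms(2) by simp
  finally show ?thesis .
qed

text \<open>In the monotone case the program only enforces that the inputs guessed for the circuit lie
  below the actual ones, which is harmless as the computed function is monotone.\<close>

lemma nbc_to_hgp:
  assumes comp: "nbc_computes n C f" and mono: "mon \<Longrightarrow> mono_boolfun n f"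
  shows "\<exists>P :: nat hgp. hgp_computes n P f \<and> hgp_degree_le 3 P \<and> (mon \<longrightarrow> hgp_mono P) \<and>
           hgp_size P \<le> 63 * nbc_size C + 27"
proof -
  let ?gs = "gates C" and ?o = "out_wire C"
  define s where "s = length ?gs"
  from comp have circ: "is_circuit n C"
    and f: "\<And>\<alpha>. length \<alpha> = n \<Longrightarrow> f \<alpha> \<longleftrightarrow> (\<exists>\<beta>. length \<beta> = n_advice C \<and> circuit_val C \<alpha> \<beta>)"
    by (auto simp: nbc_computes_def)
  have wf: "wf_gates n (n_advice C) ?gs" and o_ok: "wire_ok n (n_advice C) s ?o"
    using circ by (auto simp: is_circuit_def wf_gates_def s_def)
  \<comment> \<open>Restricting to wires that are read bounds the number of clauses by the number of
    gates alone, independently of the number of inputs and advice variables.\<close>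
  define W where "W = insert ?o (\<Union>k<s. gate_wires (?gs ! k))"
  have gW: "gate_wires (?gs ! k) \<subseteq> W" if "k < s" for k using that by (auto simp: W_def)
  have W_ok: "wire_ok n (n_advice C) s w" if "w \<in> W" for w
    using that o_ok wf wire_ok_mono unfolding W_def wf_gates_def s_def
    by (metis (no_types, lifting) UN_E insertE lessThan_iff less_imp_le)
  have finW: "finite W" by (simp add: W_def gate_wires_card)
  have "card (\<Union>k<s. gate_wires (?gs ! k)) \<le> s * 2"
    using card_UN_bounded[of "{..<s}" "\<lambda>k. gate_wires (?gs ! k)" 2] gate_wires_card by simp
  then have cardW: "card W \<le> Suc (s * 2)"
    unfolding W_def by (intro card_insert_le_Suc) (auto simp: gate_wires_card)
  define CG where "CG = (\<Union>k<s. (\<lambda>c. (c, Const False)) ` gate_clauses (Gate k) (?gs ! k))"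
  define CW where "CW = (\<Union>w\<in>W. wire_clauses mon w)"
  define \<C> where "\<C> = insert ({(?o, True)}, Const False) (CG \<union> CW)"
  have finCG: "finite CG" and finCW: "finite CW"
    using finW by (auto simp: CG_def CW_def gate_clauses_card wire_clauses_card)
  have "card ((\<lambda>c. (c, Const False)) ` gate_clauses z g) \<le> 3" for z g
    using card_image_le[OF gate_clauses_card(1)] gate_clauses_card(2) order_trans by blast
  then have "card CG \<le> s * 3"
    using card_UN_bounded[of "{..<s}" "\<lambda>k. (\<lambda>c. (c, Const False)) ` gate_clauses (Gate k) (?gs ! k)" 3]
    by (simp add: CG_def)
  moreover have "card CW \<le> card W * 2"
    unfolding CW_def using finW wire_clauses_card by (intro card_UN_bounded) auto
  \<comment> \<open>Three clauses per gate and two for each of at most \<open>2 * s + 1\<close>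
    wires. With the output clause this is \<open>7 * s + 3\<close>, and the factor 9 of
    \<open>cnf_to_hgp\<close> gives the final bound.\<close>
  ultimately have "card (CG \<union> CW) \<le> 7 * s + 2"
    using card_Un_le[of CG CW] cardW by linarith
  then have cardC: "card \<C> \<le> Suc (7 * s + 2)"
    unfolding \<C>_def using finCG finCW by (intro card_insert_le_Suc) auto
  have finC: "finite \<C>" using finCG finCW by (simp add: \<C>_def)
  have wire_label: "label_ok n (snd c)" if "c \<in> wire_clauses mon w" "w \<in> W" for c w
    using that(1) W_ok[OF that(2)] by (cases w) (auto split: if_splits)
  have "finite (fst c) \<and> card (fst c) \<le> 3 \<and> label_ok n (snd c)" if "c \<in> \<C>" for c
  proof -
    from that consider "c = ({(?o, True)}, Const False)" | "c \<in> CG" | "c \<in> CW" by (auto simp: \<C>_def)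
    then show ?thesis
    proof cases
      case 2
      then obtain k d where "d \<in> gate_clauses (Gate k) (?gs ! k)" "c = (d, Const False)"
        by (auto simp: CG_def)
      then show ?thesis using gate_clauses_card(3)[of d] by auto
    next
      case 3
      then obtain w where "w \<in> W" "c \<in> wire_clauses mon w" by (auto simp: CW_def)
      then show ?thesis using wire_label wire_clauses_card(3) by blast
    qed simp
  qed
  from cnf_to_hgp[OF finC this] obtain P :: "nat hgp" where P: "is_hgp n P"
      "hgp_size P \<le> 9 * card \<C>" "hgp_degree_le 3 P"
      "(\<forall>c\<in>\<C>. \<forall>i. snd c \<noteq> Neg i) \<longrightarrow> hgp_mono P"
      "\<And>\<alpha>. hgp_accepts P \<alpha> \<longleftrightarrow> (\<exists>\<sigma>. \<forall>c\<in>\<C>. sat_clause \<alpha> \<sigma> c)"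
    by auto
  have "hgp_mono P" if mon
  proof -
    have "snd c \<noteq> Neg i" if "c \<in> wire_clauses mon w" for c w i
      using that \<open>mon\<close> by (cases w) auto
    then show ?thesis using P(4) by (auto simp: \<C>_def CG_def CW_def)
  qed
  moreover have "hgp_size P \<le> 63 * nbc_size C + 27"
    using P(2) cardC by (simp add: nbc_size_def s_def)
  moreover have "f \<alpha> \<longleftrightarrow> hgp_accepts P \<alpha>" if len: "length \<alpha> = n" for \<alpha>
  proof -
    have sat: "(\<forall>c\<in>\<C>. sat_clause \<alpha> \<sigma> c) \<longleftrightarrow> \<sigma> ?o \<and> (\<forall>k<s. \<sigma> (Gate k) = gate_sem \<sigma> (?gs ! k)) \<and>
        (\<forall>w\<in>W. \<forall>c\<in>wire_clauses mon w. sat_clause \<alpha> \<sigma> c)" for \<sigma>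
    proof -
      have "(\<forall>c\<in>CG. sat_clause \<alpha> \<sigma> c) \<longleftrightarrow> (\<forall>k<s. \<sigma> (Gate k) = gate_sem \<sigma> (?gs ! k))"
        unfolding gate_clauses_sat[symmetric, of _ _ _ \<alpha>] by (auto simp: CG_def)
      moreover have "sat_clause \<alpha> \<sigma> ({(?o, True)}, Const False) = \<sigma> ?o" by (simp add: sat_clause_def)
      moreover have "(\<forall>c\<in>CW. sat_clause \<alpha> \<sigma> c) \<longleftrightarrow> (\<forall>w\<in>W. \<forall>c\<in>wire_clauses mon w. sat_clause \<alpha> \<sigma> c)"
        by (auto simp: CW_def)
      ultimately show ?thesis unfolding \<C>_def ball_simps ball_Un by simp
    qed
    show ?thesis
    proof
      assume "f \<alpha>"
      then obtain \<beta> where \<beta>: "circuit_val C \<alpha> \<beta>" using f[OF len] by auto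
      define \<sigma> where "\<sigma> = wire_val \<alpha> \<beta> (gate_vals \<alpha> \<beta> ?gs)"
      have out: "\<sigma> ?o" using \<beta> by (simp add: \<sigma>_def circuit_val_def)
      have gate: "\<sigma> (Gate k) = gate_sem \<sigma> (?gs ! k)" if "k < s" for k
        using gate_vals_nth[OF wf, of k] that by (simp add: \<sigma>_def s_def gate_val_eq_sem)
      have input: "\<sigma> (Input i) = \<alpha> ! i" and const: "\<sigma> (Constant b) = b" for i b
        by (simp_all add: \<sigma>_def)
      have wire: "sat_clause \<alpha> \<sigma> c" if "c \<in> wire_clauses mon w" for c w
      proof (cases w)
        case (Input i)
        then show ?thesis using that input by (cases mon) (auto simp: sat_clause_def)
      qed (use that const in \<open>auto simp: sat_clause_def\<close>)
      have "\<forall>c\<in>\<C>. sat_clause \<alpha> \<sigma> c"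
        unfolding sat by (intro conjI allI impI ballI; (rule out | erule gate | erule wire))
      then show "hgp_accepts P \<alpha>" using P(5) by blast
    next
      assume "hgp_accepts P \<alpha>"
      then obtain \<sigma> where "\<forall>c\<in>\<C>. sat_clause \<alpha> \<sigma> c" using P(5) by blast
      then have \<sigma>: "\<sigma> ?o" "\<And>k. k < s \<Longrightarrow> \<sigma> (Gate k) = gate_sem \<sigma> (?gs ! k)"
          "\<And>w c. w \<in> W \<Longrightarrow> c \<in> wire_clauses mon w \<Longrightarrow> sat_clause \<alpha> \<sigma> c"
        unfolding sat by auto
      \<comment> \<open>No clause constrains an input that is never read, so \<open>\<sigma>\<close>
        may be arbitrary there. Taking the value from \<open>\<alpha>\<close> makes \<open>x\<close>
        lie below \<open>\<alpha>\<close> in every position, with equality in the non-monotone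
        case.\<close>
      define x where "x = map (\<lambda>i. if Input i \<in> W then \<sigma> (Input i) else \<alpha> ! i) [0..<n]"
      define \<beta> where "\<beta> = map (\<lambda>j. \<sigma> (Advice j)) [0..<n_advice C]"
      define vs where "vs = gate_vals x \<beta> ?gs"
      have x_le: "x ! i \<le> \<alpha> ! i" if "i < n" for i
        using that \<sigma>(3)[of "Input i" "({(Input i, False)}, Pos i)"] by (auto simp: x_def sat_clause_def)
      have x_ge: "\<alpha> ! i \<le> x ! i" if "i < n" "\<not> mon" for i
        using that \<sigma>(3)[of "Input i" "({(Input i, True)}, Neg i)"] by (auto simp: x_def sat_clause_def)
      have wire: "wire_val x \<beta> vs w = \<sigma> w"
        if "w \<in> W" "\<And>k. w = Gate k \<Longrightarrow> vs ! k = \<sigma> (Gate k)" for w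
      proof (cases w)
        case (Constant b)
        then show ?thesis using \<sigma>(3)[OF that(1), of "({(w, b)}, Const False)"]
          by (simp add: sat_clause_def)
      qed (use that W_ok[OF that(1)] in \<open>auto simp: x_def \<beta>_def\<close>)
      \<comment> \<open>The gate clauses determine the gate values position by position: the gate
        wires read by gate \<open>k\<close> have smaller numbers, and all other wires already agree
        with \<open>\<sigma>\<close>.\<close>
      have vs: "vs ! k = \<sigma> (Gate k)" if "k < s" for k
        using that
      proof (induction k rule: less_induct)
        case (less k)
        have w: "wire_val x \<beta> vs w = \<sigma> w" if w: "w \<in> gate_wires (?gs ! k)" for w
        proof (rule wire)
          show "w \<in> W" using gW less.prems w by auto
          fix l assume l: "w = Gate l"
          have "wire_ok n (n_advice C) k w" using wf w less.prems by (simp add: wf_gates_def s_def)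
          then have "l < k" using l by simp
          then show "vs ! l = \<sigma> (Gate l)" using less by simp
        qed
        have "vs ! k = gate_sem (wire_val x \<beta> vs) (?gs ! k)"
          using gate_vals_nth[OF wf, of k] less.prems by (simp add: vs_def s_def gate_val_eq_sem)
        also have "\<dots> = gate_sem \<sigma> (?gs ! k)" using w by (cases "?gs ! k") auto
        also have "\<dots> = \<sigma> (Gate k)" using \<sigma>(2)[OF less.prems] by simp
        finally show ?case .
      qed
      have "wire_val x \<beta> vs ?o = \<sigma> ?o"
        using vs o_ok by (intro wire) (auto simp: W_def)
      then have "circuit_val C x \<beta>" using \<sigma>(1) by (simp add: circuit_val_def vs_def)
      moreover have lenx: "length x = n" "length \<beta> = n_advice C" by (simp_all add: x_def \<beta>_def)
      ultimately have fx: "f x" using f by blast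
      show "f \<alpha>"
      proof (cases mon)
        case True
        have "list_all2 (\<le>) x \<alpha>" using x_le lenx len by (auto simp: list_all2_conv_all_nth)
        then show ?thesis using mono[OF True] fx lenx len by (auto simp: mono_boolfun_def)
      next
        case False
        then have "x = \<alpha>" using x_le x_ge lenx len by (intro nth_equalityI) (auto intro!: antisym)
        with fx show ?thesis by simp
      qed
    qed
  qed
  ultimately show ?thesis using P(1,3) by (intro exI[of _ P]) (auto simp: hgp_computes_def)
qed

section \<open>Existence of programs\<close>

text \<open>One hyperedge per satisfying assignment \<open>\<gamma>\<close>; it covers the vertices labelled by literals that
  \<open>\<gamma>\<close> makes false.\<close>

lemma hgp_exists:
  assumes mono: "mon \<Longrightarrow> mono_boolfun n f"
  shows "\<exists>P :: nat hgp. hgp_computes n P f \<and> (mon \<longrightarrow> hgp_mono P)"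
proof -
  define X where "X = {\<gamma>. length \<gamma> = n \<and> f \<gamma>}"
  \<comment> \<open>The first constraint forces exactly one satisfying assignment to be selected; if
    there is none, its vertex lies in no hyperedge and every input is rejected. The
    \<open>Pos\<close> constraints put the selected assignment below the input, and the
    \<open>Neg\<close> constraints put it above.\<close>
  define K where "K = insert (X, Const False) ((\<lambda>i. ({\<gamma>\<in>X. \<not> \<gamma> ! i}, Pos i)) ` {..<n} \<union>
    (if mon then {} else (\<lambda>i. ({\<gamma>\<in>X. \<gamma> ! i}, Neg i)) ` {..<n}))"
  have "finite {\<gamma> :: bool list. set \<gamma> \<subseteq> UNIV \<and> length \<gamma> = n}" by (intro finite_lists_length_eq) simp
  then have finX: "finite X" by (rule rev_finite_subset) (auto simp: X_def)
  have finK: "finite K" by (simp add: K_def)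
  have "T \<subseteq> X \<and> label_ok n l" if "(T, l) \<in> K" for T l
    using that by (auto simp: K_def split: if_splits)
  from constraints_to_hgp[of X K n, OF finX finK this] obtain P :: "nat hgp" where
    P: "is_hgp n P" "(\<forall>k\<in>K. \<forall>i. snd k \<noteq> Neg i) \<longrightarrow> hgp_mono P"
      "\<And>\<alpha>. hgp_accepts P \<alpha> \<longleftrightarrow>
              (\<exists>Y\<subseteq>X. \<forall>k\<in>K. (\<forall>x\<in>Y \<inter> fst k. \<forall>y\<in>Y \<inter> fst k. x = y) \<and>
                 (\<not> label_val \<alpha> (snd k) \<longrightarrow> Y \<inter> fst k \<noteq> {}))"
    by auto
  have "hgp_mono P" if mon using P(2) that by (auto simp: K_def)
  moreover have "f \<alpha> \<longleftrightarrow> hgp_accepts P \<alpha>" if len: "length \<alpha> = n" for \<alpha>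
  proof
    assume "f \<alpha>"
    then have "\<alpha> \<in> X" using len by (simp add: X_def)
    then show "hgp_accepts P \<alpha>" unfolding P(3)
      by (intro exI[of _ "{\<alpha>}"]) (auto simp: K_def split: if_splits)
  next
    assume "hgp_accepts P \<alpha>"
    then obtain Y where Y: "Y \<subseteq> X"
        "\<And>k x y. k \<in> K \<Longrightarrow> x \<in> Y \<inter> fst k \<Longrightarrow> y \<in> Y \<inter> fst k \<Longrightarrow> x = y"
        "\<And>k. k \<in> K \<Longrightarrow> \<not> label_val \<alpha> (snd k) \<Longrightarrow> Y \<inter> fst k \<noteq> {}"
      unfolding P(3) by metis
    have XK: "(X, Const False) \<in> K" by (simp add: K_def)
    from Y(3)[OF XK] obtain \<gamma> where \<gamma>: "\<gamma> \<in> Y" by auto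
    have uniq: "y = \<gamma>" if "y \<in> Y" for y using Y(2)[OF XK, of y \<gamma>] \<gamma> that Y(1) by auto
    have len\<gamma>: "length \<gamma> = n" "f \<gamma>" using \<gamma> Y(1) by (auto simp: X_def)
    have le: "\<gamma> ! i \<le> \<alpha> ! i" if "i < n" for i
    proof -
      have "({\<gamma>\<in>X. \<not> \<gamma> ! i}, Pos i) \<in> K" using that by (simp add: K_def)
      from Y(3)[OF this] uniq show ?thesis by auto
    qed
    have ge: "\<alpha> ! i \<le> \<gamma> ! i" if "i < n" "\<not> mon" for i
    proof -
      have "({\<gamma>\<in>X. \<gamma> ! i}, Neg i) \<in> K" using that by (simp add: K_def)
      from Y(3)[OF this] uniq show ?thesis by auto
    qed
    show "f \<alpha>"
    proof (cases mon)
      case True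
      have "list_all2 (\<le>) \<gamma> \<alpha>" using le len\<gamma> len by (auto simp: list_all2_conv_all_nth)
      then show ?thesis using mono[OF True] len\<gamma> len by (auto simp: mono_boolfun_def)
    next
      case False
      then have "\<gamma> = \<alpha>" using le ge len\<gamma> len by (intro nth_equalityI) (auto intro!: antisym)
      with len\<gamma> show ?thesis by simp
    qed
  qed
  ultimately show ?thesis using P(1) by (intro exI[of _ P]) (auto simp: hgp_computes_def)
qed

section \<open>Polynomial relations\<close>

lemma poly_nat_mono: "x \<le> y \<Longrightarrow> poly p x \<le> poly p y" for p :: "nat poly"
  by (induction p) (auto intro!: add_mono mult_mono)

text \<open>Existence of some \<open>s\<close> ensures that the minimum for \<open>A\<close> is
  attained, so the translation can be applied to an optimal object.\<close>

lemma LEAST_transfer: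
  fixes A B :: "nat \<Rightarrow> bool" and g :: "nat \<Rightarrow> nat"
  assumes "\<exists>s. A s" "\<And>s. A s \<Longrightarrow> \<exists>t \<le> g s. B t"
  shows "(LEAST t. B t) \<le> g (LEAST s. A s)"
proof -
  from assms(1) have "A (LEAST s. A s)" by (rule LeastI_ex)
  from assms(2)[OF this] obtain t where "t \<le> g (LEAST s. A s)" "B t" by blast
  with Least_le[of B t] show ?thesis by simp
qed

text \<open>\<open>H\<close>, \<open>D\<close> and \<open>N\<close> stand for the sizes attained by
  programs, programs of degree at most 3, and circuits. The translations form a cycle from
  \<open>H\<close> to \<open>N\<close> to \<open>D\<close> and back to \<open>H\<close>, and the six
  bounds are compositions along it. The number \<open>n\<close> of variables enters only in the
  passage from \<open>H\<close> to \<open>N\<close>, and existence of programs is carried along the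
  cycle.\<close>

lemma poly_related:
  fixes H D N :: "nat \<Rightarrow> (bool list \<Rightarrow> bool) \<Rightarrow> nat \<Rightarrow> bool" and p q :: "nat poly"
  assumes ex: "\<And>n f. F n f \<Longrightarrow> \<exists>s. H n f s"
    and DH: "\<And>n f s. D n f s \<Longrightarrow> H n f s"
    and HN: "\<And>n f s. F n f \<Longrightarrow> H n f s \<Longrightarrow> \<exists>t \<le> poly p (n + s). N n f t"
    and ND: "\<And>n f s. F n f \<Longrightarrow> N n f s \<Longrightarrow> \<exists>t \<le> poly q s. D n f t"
  defines "h \<equiv> \<lambda>n f. LEAST s. H n f s" and "d \<equiv> \<lambda>n f. LEAST s. D n f s"
    and "m \<equiv> \<lambda>n f. LEAST s. N n f s"
  shows "poly_bounded F h d \<and> poly_bounded F h m \<and> poly_bounded F d (\<lambda>n f. n + h n f) \<and>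
    poly_bounded F d m \<and> poly_bounded F m (\<lambda>n f. n + h n f) \<and> poly_bounded F m (\<lambda>n f. n + d n f)"
proof -
  have bounds: "h n f \<le> d n f" "m n f \<le> poly p (n + h n f)" "d n f \<le> poly q (m n f)"
    if F: "F n f" for n f
  proof -
    from ex[OF F] HN[OF F] have exN: "\<exists>s. N n f s" by blast
    with ND[OF F] have exD: "\<exists>s. D n f s" by blast
    show "h n f \<le> d n f"
      unfolding h_def d_def using DH by (intro LEAST_transfer[where g = "\<lambda>s. s", OF exD]) blast
    show "m n f \<le> poly p (n + h n f)"
      unfolding h_def m_def by (rule LEAST_transfer[where g = "\<lambda>s. poly p (n + s)", OF ex[OF F] HN[OF F]])
    show "d n f \<le> poly q (m n f)"
      unfolding d_def m_def by (rule LEAST_transfer[OF exN ND[OF F]])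
  qed
  have "poly_bounded F h d" unfolding poly_bounded_def using bounds(1)
    by (intro exI[of _ "[:0, 1:]"]) simp
  moreover have "poly_bounded F d m" unfolding poly_bounded_def using bounds(3) by blast
  moreover have "poly_bounded F h m" unfolding poly_bounded_def using bounds(1,3) order_trans by blast
  moreover have "poly_bounded F m (\<lambda>n f. n + h n f)" unfolding poly_bounded_def using bounds(2) by blast
  moreover have "poly_bounded F m (\<lambda>n f. n + d n f)"
  proof -
    have "m n f \<le> poly p (n + d n f)" if "F n f" for n f
      using bounds(2)[OF that] poly_nat_mono[of "n + h n f" "n + d n f" p] bounds(1)[OF that] by simp
    then show ?thesis unfolding poly_bounded_def by blast
  qed
  moreover have "poly_bounded F d (\<lambda>n f. n + h n f)"
  proof -
    \<comment> \<open>Going through circuits composes the two polynomials; polynomials over the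
      naturals are monotone, so the inner bound may be inserted into \<open>q\<close>.\<close>
    have "d n f \<le> poly (pcompose q p) (n + h n f)" if "F n f" for n f
      using bounds(3)[OF that] poly_nat_mono[OF bounds(2)[OF that], of q] by (simp add: poly_pcompose)
    then show ?thesis unfolding poly_bounded_def by blast
  qed
  ultimately show ?thesis by blast
qed

text \<open>The bound of \<open>hgp_to_nbc\<close> with both the number of variables and the number
  of hyperedges replaced by their sum, which turns it into a polynomial in one variable.\<close>

definition nbc_poly :: "nat poly" where
  "nbc_poly = [:0, 0, 4:] + [:2, 2:] * [:1, 1:] * [:3, 1:] + 1"

lemma hgp_to_nbc_poly:
  assumes "hgp_computes n P f"
  shows "\<exists>C. nbc_computes n C f \<and> (hgp_mono P \<longrightarrow> nbc_mono C) \<and>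
           nbc_size C \<le> poly nbc_poly (n + hgp_size P)"
proof -
  let ?m = "hgp_size P" and ?N = "n + hgp_size P"
  have "4 * ?m * ?m + (2 * n + 2) * (?m + 1) * (?m + 3) + 1 \<le>
      4 * ?N * ?N + (2 * ?N + 2) * (?N + 1) * (?N + 3) + 1"
    by (intro add_mono mult_mono) auto
  also have "\<dots> = poly nbc_poly ?N" by (simp add: nbc_poly_def algebra_simps)
  finally show ?thesis using hgp_to_nbc[OF assms] order_trans by blast
qed

theorem theorem7:
  shows
   "(poly_bounded (\<lambda>n f. True) HGP (HGP_deg 3) \<and>
     poly_bounded (\<lambda>n f. True) HGP NBC \<and>
     poly_bounded (\<lambda>n f. True) (HGP_deg 3) (\<lambda>n f. n + HGP n f) \<and>
     poly_bounded (\<lambda>n f. True) (HGP_deg 3) NBC \<and>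
     poly_bounded (\<lambda>n f. True) NBC (\<lambda>n f. n + HGP n f) \<and>
     poly_bounded (\<lambda>n f. True) NBC (\<lambda>n f. n + HGP_deg 3 n f)) \<and>
    (poly_bounded mono_boolfun HGP_mono (HGP_deg_mono 3) \<and>
     poly_bounded mono_boolfun HGP_mono NBC_mono \<and>
     poly_bounded mono_boolfun (HGP_deg_mono 3) (\<lambda>n f. n + HGP_mono n f) \<and>
     poly_bounded mono_boolfun (HGP_deg_mono 3) NBC_mono \<and>
     poly_bounded mono_boolfun NBC_mono (\<lambda>n f. n + HGP_mono n f) \<and>
     poly_bounded mono_boolfun NBC_mono (\<lambda>n f. n + HGP_deg_mono 3 n f))"
proof (rule conjI)
  show "poly_bounded (\<lambda>n f. True) HGP (HGP_deg 3) \<and>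
     poly_bounded (\<lambda>n f. True) HGP NBC \<and>
     poly_bounded (\<lambda>n f. True) (HGP_deg 3) (\<lambda>n f. n + HGP n f) \<and>
     poly_bounded (\<lambda>n f. True) (HGP_deg 3) NBC \<and>
     poly_bounded (\<lambda>n f. True) NBC (\<lambda>n f. n + HGP n f) \<and>
     poly_bounded (\<lambda>n f. True) NBC (\<lambda>n f. n + HGP_deg 3 n f)"
    unfolding HGP_def[abs_def] HGP_deg_def[abs_def] NBC_def[abs_def]
  \<comment> \<open>The coefficients of \<open>q\<close>, constant term first, are those of the
    linear bound in \<open>nbc_to_hgp\<close>.\<close>
  proof (rule poly_related[where p = nbc_poly and q = "[:27, 63:]"])
    fix n f
    show "\<exists>s. \<exists>P :: nat hgp. hgp_computes n P f \<and> hgp_size P = s"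
      using hgp_exists[of False n f] by blast
  next
    fix n f s
    assume "\<exists>P :: nat hgp. hgp_computes n P f \<and> hgp_size P = s"
    then show "\<exists>t \<le> poly nbc_poly (n + s). \<exists>C. nbc_computes n C f \<and> nbc_size C = t"
      using hgp_to_nbc_poly by blast
  next
    fix n f s
    assume "\<exists>C. nbc_computes n C f \<and> nbc_size C = s"
    then obtain C where C: "nbc_computes n C f" "nbc_size C = s" by blast
    from nbc_to_hgp[OF C(1), of False] C(2)
    show "\<exists>t \<le> poly [:27, 63:] s.
        \<exists>P :: nat hgp. hgp_computes n P f \<and> hgp_degree_le 3 P \<and> hgp_size P = t"
      by (auto simp: algebra_simps)
  qed blast
  show "poly_bounded mono_boolfun HGP_mono (HGP_deg_mono 3) \<and>
     poly_bounded mono_boolfun HGP_mono NBC_mono \<and>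
     poly_bounded mono_boolfun (HGP_deg_mono 3) (\<lambda>n f. n + HGP_mono n f) \<and>
     poly_bounded mono_boolfun (HGP_deg_mono 3) NBC_mono \<and>
     poly_bounded mono_boolfun NBC_mono (\<lambda>n f. n + HGP_mono n f) \<and>
     poly_bounded mono_boolfun NBC_mono (\<lambda>n f. n + HGP_deg_mono 3 n f)"
    unfolding HGP_mono_def[abs_def] HGP_deg_mono_def[abs_def] NBC_mono_def[abs_def]
  proof (rule poly_related[where p = nbc_poly and q = "[:27, 63:]"])
    fix n f
    assume "mono_boolfun n f"
    then show "\<exists>s. \<exists>P :: nat hgp. hgp_computes n P f \<and> hgp_mono P \<and> hgp_size P = s"
      using hgp_exists[of True n f] by blast
  next
    fix n f s
    assume "\<exists>P :: nat hgp. hgp_computes n P f \<and> hgp_mono P \<and> hgp_size P = s"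
    then show "\<exists>t \<le> poly nbc_poly (n + s). \<exists>C. nbc_computes n C f \<and> nbc_mono C \<and> nbc_size C = t"
      using hgp_to_nbc_poly by blast
  next
    fix n f s
    assume mono: "mono_boolfun n f" and "\<exists>C. nbc_computes n C f \<and> nbc_mono C \<and> nbc_size C = s"
    then obtain C where C: "nbc_computes n C f" "nbc_size C = s" by blast
    from nbc_to_hgp[OF C(1), of True] mono C(2)
    show "\<exists>t \<le> poly [:27, 63:] s. \<exists>P :: nat hgp.
        hgp_computes n P f \<and> hgp_degree_le 3 P \<and> hgp_mono P \<and> hgp_size P = t"
      by (auto simp: algebra_simps)
  qed blast
qed

end
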